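(* Let $G$ be a connected non-bipartite graph and let $n\geq 7$ be an odd integer. If $\kappa(G\times K_{2})>\frac{4}{n-1}\delta(G)$, then $G\times C_{n}$ is super-$\kappa$.
   Context: All graphs are simple. $C_n$ is the cycle on $n$ vertices and $K_2$ the complete graph on 2 vertices. The direct product $G\times H$ has vertex set $V(G)\times V(H)$, with $(u_1,v_1)(u_2,v_2)$ an edge iff $u_1u_2\in E(G)$ and $v_1v_2\in E(H)$. $\delta(G)$ is the minimum degree. For a non-complete graph $G$, the connectivity $\kappa(G)$ is the minimum size of a vertex set $S$ such that $G-S$ is disconnected; for a complete graph $\kappa(G)=|V(G)|-1$. A graph is super connected (super-$\kappa$) if every minimum vertex cut is the neighborhood of some vertex of minimum degree. *)

theory Defs
  imports Complex_Main "Graph_Theory.Graph_Theory"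
begin

text \<open>
  A finite simple graph is a \<^locale>\<open>pair_graph\<close>: a finite, loop-free, symmetric digraph whose
  arcs are pairs of vertices, so that an edge \<open>uv\<close> is the two arcs \<open>(u, v)\<close> and \<open>(v, u)\<close>.
\<close>

definition cycle_graph :: "nat \<Rightarrow> nat pair_pre_digraph" where
  "cycle_graph n = \<lparr> pverts = {..<n},
     parcs = {(i, j). i < n \<and> j < n \<and> (j = Suc i mod n \<or> i = Suc j mod n)} \<rparr>"

definition complete_graph :: "nat \<Rightarrow> nat pair_pre_digraph" where
  "complete_graph n = \<lparr> pverts = {..<n}, parcs = {(i, j). i < n \<and> j < n \<and> i \<noteq> j} \<rparr>"

definition direct_product ::
    "'a pair_pre_digraph \<Rightarrow> 'b pair_pre_digraph \<Rightarrow> ('a \<times> 'b) pair_pre_digraph" where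
  "direct_product G H = \<lparr> pverts = pverts G \<times> pverts H,
     parcs = {((u1, v1), (u2, v2)) | u1 v1 u2 v2. (u1, u2) \<in> parcs G \<and> (v1, v2) \<in> parcs H} \<rparr>"

definition bipartite :: "'a pair_pre_digraph \<Rightarrow> bool" where
  "bipartite G \<longleftrightarrow>
     (\<exists>X Y. X \<union> Y = pverts G \<and> X \<inter> Y = {} \<and> parcs G \<subseteq> X \<times> Y \<union> Y \<times> X)"

definition neighborhood :: "'a pair_pre_digraph \<Rightarrow> 'a \<Rightarrow> 'a set" where
  "neighborhood G v = {u. (v, u) \<in> parcs G}"

text \<open>In a symmetric digraph without parallel arcs the out-degree is the degree.\<close>

definition min_degree :: "'a pair_pre_digraph \<Rightarrow> nat" where
  "min_degree G = Min ((\<lambda>v. out_degree G v) ` pverts G)"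

text \<open>
  The graph without vertices is not connected in the sense of
  \<^const>\<open>Digraph_Component.connected\<close>, but it is not disconnected either, so \<open>S\<close> must leave
  at least one vertex. If \<open>G\<close> is itself disconnected, then \<open>{}\<close> is a vertex cut.
\<close>

definition vertex_cut :: "'a pair_pre_digraph \<Rightarrow> 'a set \<Rightarrow> bool" where
  "vertex_cut G S \<longleftrightarrow> S \<subseteq> pverts G \<and> pverts G - S \<noteq> {} \<and>
     \<not> Digraph_Component.connected (with_proj G \<restriction> (pverts G - S))"

definition connectivity :: "'a pair_pre_digraph \<Rightarrow> nat" where
  "connectivity G =
     (if complete_digraph (card (pverts G)) (with_proj G) then card (pverts G) - 1
      else (LEAST k. \<exists>S. vertex_cut G S \<and> card S = k))"

definition minimum_vertex_cut :: "'a pair_pre_digraph \<Rightarrow> 'a set \<Rightarrow> bool" where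
  "minimum_vertex_cut G S \<longleftrightarrow> vertex_cut G S \<and> (\<forall>T. vertex_cut G T \<longrightarrow> card S \<le> card T)"

definition super_connected :: "'a pair_pre_digraph \<Rightarrow> bool" where
  "super_connected G \<longleftrightarrow>
     (\<forall>S. minimum_vertex_cut G S \<longrightarrow>
        (\<exists>v \<in> pverts G. out_degree G v = min_degree G \<and> S = neighborhood G v))"

lemma pair_graph_iff:
  "pair_graph G \<longleftrightarrow> finite (pverts G) \<and> parcs G \<subseteq> pverts G \<times> pverts G \<and>
     sym (parcs G) \<and> irrefl (parcs G)"
proof
  assume "pair_graph G"
  then interpret pair_graph G .
  show "finite (pverts G) \<and> parcs G \<subseteq> pverts G \<times> pverts G \<and> sym (parcs G) \<and> irrefl (parcs G)"
    using pair_finite_verts pair_sym_arcs pair_no_loops wellformed'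
    by (fastforce simp: symmetric_def irrefl_def)
next
  assume *: "finite (pverts G) \<and> parcs G \<subseteq> pverts G \<times> pverts G \<and> sym (parcs G) \<and> irrefl (parcs G)"
  then have "finite (parcs G)"
    by (meson finite_SigmaI finite_subset)
  with * show "pair_graph G"
    by unfold_locales (auto simp: symmetric_def irrefl_def)
qed

lemma pair_graph_complete_graph: "pair_graph (complete_graph n)"
  by (auto simp: pair_graph_iff complete_graph_def sym_def irrefl_def)

lemma pair_graph_cycle_graph:
  assumes "n \<ge> 2"
  shows "pair_graph (cycle_graph n)"
  using assms by (auto simp: pair_graph_iff cycle_graph_def sym_def irrefl_def mod_Suc)

lemma pair_graph_direct_product:
  assumes "pair_graph G" "pair_graph H"
  shows "pair_graph (direct_product G H)"
  using assms unfolding pair_graph_iff direct_product_def sym_def irrefl_def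
  by (auto 0 4)

end

theory Submission
  imports Defs
begin

text \<open>
  Let \<open>S\<close> be a minimum cut, so \<open>card S \<le> 2 * min_degree G\<close>. Averaging over the \<open>n\<close> pairs of
  consecutive layers gives a pair that meets \<open>S\<close> in fewer than \<open>\<kappa>(G \<times> K\<^sub>2)\<close> vertices; what remains
  of these two layers is connected. Cutting the cycle there, some component \<open>C\<close> avoids both of them.
  The layers just below and just above \<open>C\<close> each contain the neighbours in \<open>G\<close> of a vertex, hence at
  least \<open>min_degree G\<close> vertices of \<open>S\<close>, and so make up all of \<open>S\<close>. If \<open>C\<close> met two or more layers,
  connectedness of \<open>G \<times> K\<^sub>2\<close> would make it fill whole layers, and \<open>S\<close> would contain a whole
  layer, which is too large. So \<open>C\<close> lies in one layer, and \<open>S\<close> is the neighbourhood of any vertex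
  of \<open>C\<close>.
\<close>

section \<open>Vertex cuts described by closed sets\<close>

text \<open>Trades reachability for a union \<open>A\<close> of components. Forwards,
  \<open>A\<close> is what one vertex reaches outside \<open>S\<close>; backwards, a walk avoiding
  \<open>S\<close> cannot leave \<open>A\<close>.\<close>

lemma vertex_cut_iff:
  assumes "pair_graph P"
  shows "vertex_cut P S \<longleftrightarrow> S \<subseteq> pverts P \<and>
    (\<exists>A. A \<noteq> {} \<and> A \<subset> pverts P - S \<and> (\<forall>u\<in>A. neighborhood P u \<subseteq> A \<union> S))"
proof -
  have sym: "sym (parcs P)" and wf: "parcs P \<subseteq> pverts P \<times> pverts P"
    using assms by (auto simp: pair_graph_iff)
  \<comment> \<open>Connectedness is defined through the symmetric closure; \<open>P\<close> is
    symmetric, so no arcs are added, as \<open>ends\<close> records.\<close>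
  let ?H = "with_proj (mk_symmetric (with_proj P \<restriction> (pverts P - S)))"
  have verts: "verts ?H = pverts P - S"
    by simp
  have ends: "arcs_ends ?H = {(u, v) \<in> parcs P. u \<notin> S \<and> v \<notin> S}"
    using sym wf by (fastforce simp: parcs_mk_symmetric dest: symD)
  have conn: "Digraph_Component.connected (with_proj P \<restriction> (pverts P - S)) \<longleftrightarrow>
    pverts P - S \<noteq> {} \<and> (\<forall>u\<in>pverts P - S. \<forall>v\<in>pverts P - S. u \<rightarrow>\<^sup>*\<^bsub>?H\<^esub> v)"
    unfolding connected_def strongly_connected_def verts by simp
  show ?thesis
  proof (intro iffI conjI)
    assume cut: "vertex_cut P S"
    then show "S \<subseteq> pverts P"
      by (simp add: vertex_cut_def)
    from cut obtain u v where u: "u \<in> pverts P - S" and v: "v \<in> pverts P - S"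
      and nr: "\<not> u \<rightarrow>\<^sup>*\<^bsub>?H\<^esub> v"
      unfolding vertex_cut_def conn by blast
    let ?A = "{w. u \<rightarrow>\<^sup>*\<^bsub>?H\<^esub> w}"
    have sub: "?A \<subseteq> pverts P - S"
      unfolding reachable_def verts by (auto dest: in_rtrancl_on_in_F)
    show "\<exists>A. A \<noteq> {} \<and> A \<subset> pverts P - S \<and> (\<forall>u\<in>A. neighborhood P u \<subseteq> A \<union> S)"
    proof (intro exI[of _ ?A] conjI ballI subsetI)
      have "u \<in> ?A"
        using u unfolding reachable_def verts by simp
      then show "?A \<noteq> {}"
        by (metis empty_iff)
      show "?A \<subset> pverts P - S"
        using sub v nr by blast
      fix w z assume w: "w \<in> ?A" and z: "z \<in> neighborhood P w"
      show "z \<in> ?A \<union> S"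
      proof (cases "z \<in> S")
        case False
        then have "(w, z) \<in> arcs_ends ?H" "z \<in> verts ?H"
          using w z sub wf unfolding ends verts neighborhood_def by auto
        then show ?thesis
          using w unfolding reachable_def by (auto intro: rtrancl_on_into_rtrancl_on)
      qed simp
    qed
  next
    assume R: "S \<subseteq> pverts P \<and>
      (\<exists>A. A \<noteq> {} \<and> A \<subset> pverts P - S \<and> (\<forall>u\<in>A. neighborhood P u \<subseteq> A \<union> S))"
    then obtain A u v where A: "\<forall>u\<in>A. neighborhood P u \<subseteq> A \<union> S" and u: "u \<in> A"
      and uv: "u \<in> pverts P - S" "v \<in> pverts P - S" and v: "v \<notin> A"
      by blast
    have "w \<in> A" if "(u, w) \<in> rtrancl_on (verts ?H) (arcs_ends ?H)" for w
      using that
    proof (induction rule: rtrancl_on_induct)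
      case (step b c)
      then show ?case
        using A unfolding ends neighborhood_def by blast
    qed (use u in simp)
    then have "\<not> u \<rightarrow>\<^sup>*\<^bsub>?H\<^esub> v"
      using v unfolding reachable_def by blast
    then show "vertex_cut P S"
      using R uv unfolding vertex_cut_def conn by blast
  qed
qed

section \<open>Neighbourhoods, minimum degree and connectivity\<close>

lemma neighborhood_subset:
  assumes "pair_graph P"
  shows "neighborhood P v \<subseteq> pverts P"
  using assms by (auto simp: pair_graph_iff neighborhood_def)

lemma finite_neighborhood:
  assumes "pair_graph P"
  shows "finite (neighborhood P v)"
  using assms neighborhood_subset finite_subset by (metis pair_graph_iff)

lemma out_degree_eq_card_neighborhood: "out_degree (with_proj P) v = card (neighborhood P v)"
proof -
  have "out_arcs (with_proj P) v = Pair v ` neighborhood P v"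
    by (auto simp: out_arcs_def neighborhood_def)
  then show ?thesis
    by (simp add: out_degree_def card_image inj_on_def)
qed

lemma min_degree_le_card_neighborhood:
  assumes "pair_graph P" and "v \<in> pverts P"
  shows "min_degree P \<le> card (neighborhood P v)"
  using assms by (auto simp: min_degree_def out_degree_eq_card_neighborhood pair_graph_iff)

lemma min_degree_attained:
  assumes "pair_graph P" and "pverts P \<noteq> {}"
  obtains v where "v \<in> pverts P" and "card (neighborhood P v) = min_degree P"
proof -
  have "min_degree P \<in> (\<lambda>v. card (neighborhood P v)) ` pverts P"
    unfolding min_degree_def out_degree_eq_card_neighborhood
    using assms by (intro Min_in) (auto simp: pair_graph_iff)
  then show thesis
    using that by auto
qed

lemma min_degree_less_card:
  assumes "pair_graph P" and "pverts P \<noteq> {}"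
  shows "min_degree P < card (pverts P)"
proof -
  obtain v where v: "v \<in> pverts P"
    using assms by blast
  have "neighborhood P v \<subset> pverts P"
    using assms v by (auto simp: pair_graph_iff neighborhood_def irrefl_def)
  then have "card (neighborhood P v) < card (pverts P)"
    using assms by (simp add: pair_graph_iff psubset_card_mono)
  then show ?thesis
    using min_degree_le_card_neighborhood[OF assms(1) v] by simp
qed

text \<open>Deleting its neighbourhood isolates \<open>v\<close>, while \<open>w\<close> survives as
  a second vertex.\<close>

lemma vertex_cut_neighborhood:
  assumes "pair_graph P" and "v \<in> pverts P" and "w \<in> pverts P" and "v \<noteq> w"
    and "(v, w) \<notin> parcs P"
  shows "vertex_cut P (neighborhood P v)"
  unfolding vertex_cut_iff[OF assms(1)]
proof (intro conjI exI[of _ "{v}"])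
  show "{v} \<subset> pverts P - neighborhood P v"
    using assms by (auto simp: neighborhood_def pair_graph_iff irrefl_def)
qed (use neighborhood_subset[OF assms(1)] in auto)

text \<open>A cut separates two non-adjacent vertices, which rules out the complete case in the
  definition of \<open>connectivity\<close>.\<close>

lemma connectivity_le_card_vertex_cut:
  assumes P: "pair_graph P" and cut: "vertex_cut P S"
  shows "connectivity P \<le> card S"
proof -
  obtain A u v where "\<forall>u\<in>A. neighborhood P u \<subseteq> A \<union> S" "u \<in> A"
    "u \<in> pverts P - S" "v \<in> pverts P - S" "v \<notin> A"
    using cut unfolding vertex_cut_iff[OF P] by blast
  then have "(u, v) \<notin> parcs P" "u \<noteq> v" "u \<in> pverts P" "v \<in> pverts P"
    by (auto simp: neighborhood_def)
  then have "\<not> complete_digraph (card (pverts P)) (with_proj P)"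
    unfolding complete_digraph_pair_def by blast
  then have "connectivity P = (LEAST k. \<exists>S. vertex_cut P S \<and> card S = k)"
    by (simp add: connectivity_def)
  also have "\<dots> \<le> card S"
    using cut by (intro Least_le) blast
  finally show ?thesis .
qed

section \<open>Direct products, in particular with the complete graph on two vertices\<close>

lemma parcs_complete_graph_2: "parcs (complete_graph 2) = {(0, 1), (1, 0)}"
  by (auto simp: complete_graph_def)

lemma pverts_complete_graph_2: "pverts (complete_graph 2) = {0, 1}"
  by (auto simp: complete_graph_def)

lemma neighborhood_direct_product:
  "neighborhood (direct_product G H) (u, v) = neighborhood G u \<times> neighborhood H v"
  by (auto simp: neighborhood_def direct_product_def)

lemma pverts_direct_product: "pverts (direct_product G H) = pverts G \<times> pverts H"
  by (simp add: direct_product_def)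

lemma not_adjacent_same_fst:
  assumes "pair_graph G"
  shows "((x, i), (x, j)) \<notin> parcs (direct_product G H)"
  using assms by (auto simp: direct_product_def pair_graph_iff irrefl_def)

text \<open>For \<open>v\<close> of minimum degree, the neighbours of \<open>(v, 0)\<close> form a
  copy of those of \<open>v\<close>, and they separate it from \<open>(v, 1)\<close>.\<close>

lemma connectivity_direct_product_K2_le:
  assumes G: "pair_graph G" and ne: "pverts G \<noteq> {}"
  shows "connectivity (direct_product G (complete_graph 2)) \<le> min_degree G"
proof -
  let ?B = "direct_product G (complete_graph 2)"
  have B: "pair_graph ?B"
    using G pair_graph_complete_graph by (rule pair_graph_direct_product)
  obtain v where v: "v \<in> pverts G" "card (neighborhood G v) = min_degree G"
    using min_degree_attained[OF assms] by blast
  have "vertex_cut ?B (neighborhood ?B (v, 0))"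
    using v
    by (intro vertex_cut_neighborhood[OF B, where w = "(v, 1)"])
       (auto simp: pverts_direct_product pverts_complete_graph_2 not_adjacent_same_fst[OF G])
  then have "connectivity ?B \<le> card (neighborhood ?B (v, 0))"
    by (rule connectivity_le_card_vertex_cut[OF B])
  moreover have "neighborhood (complete_graph 2) 0 = {1}"
    by (auto simp: neighborhood_def parcs_complete_graph_2)
  ultimately show ?thesis
    using v by (simp add: neighborhood_direct_product card_cartesian_product)
qed

text \<open>Used for two consecutive layers. If \<open>X\<close> and \<open>Y\<close> were neither
  both empty nor both everything left, the copies of \<open>S\<close> and \<open>T\<close> would be
  a cut of the product that is too small.\<close>

lemma direct_product_K2_closed:
  assumes G: "pair_graph G"
    and few: "card S + card T < connectivity (direct_product G (complete_graph 2))"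
    and ST: "S \<subseteq> pverts G" "T \<subseteq> pverts G"
    and XY: "X \<subseteq> pverts G - S" "Y \<subseteq> pverts G - T"
    and X: "\<And>x. x \<in> X \<Longrightarrow> neighborhood G x \<subseteq> Y \<union> T"
    and Y: "\<And>y. y \<in> Y \<Longrightarrow> neighborhood G y \<subseteq> X \<union> S"
  shows "X = {} \<and> Y = {} \<or> X = pverts G - S \<and> Y = pverts G - T"
proof (rule ccontr)
  assume neg: "\<not> ?thesis"
  let ?B = "direct_product G (complete_graph 2)"
  let ?A = "X \<times> {0} \<union> Y \<times> {1::nat}" and ?S = "S \<times> {0} \<union> T \<times> {1::nat}"
  have B: "pair_graph ?B"
    using G pair_graph_complete_graph by (rule pair_graph_direct_product)
  have "vertex_cut ?B ?S"
    unfolding vertex_cut_iff[OF B]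
  proof (intro conjI exI[of _ ?A] ballI)
    show "?S \<subseteq> pverts ?B"
      using ST by (auto simp: pverts_direct_product pverts_complete_graph_2)
    show "?A \<noteq> {}"
      using neg XY by auto
    show "?A \<subset> pverts ?B - ?S"
    proof
      show "?A \<subseteq> pverts ?B - ?S"
        using XY by (auto simp: pverts_direct_product pverts_complete_graph_2)
      have "pverts G - S \<subseteq> X \<and> pverts G - T \<subseteq> Y" if "?A = pverts ?B - ?S"
        using that unfolding pverts_direct_product pverts_complete_graph_2 set_eq_iff by auto
      then show "?A \<noteq> pverts ?B - ?S"
        using neg XY by blast
    qed
    fix u assume "u \<in> ?A"
    then show "neighborhood ?B u \<subseteq> ?A \<union> ?S"
      using X Y by (fastforce simp: neighborhood_def direct_product_def parcs_complete_graph_2)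
  qed
  then have "connectivity ?B \<le> card ?S"
    by (rule connectivity_le_card_vertex_cut[OF B])
  also have "\<dots> \<le> card S + card T"
    using card_Un_le[of "S \<times> {0::nat}" "T \<times> {1}"] by (simp add: card_cartesian_product)
  finally show False
    using few by simp
qed

section \<open>A closed set in a row of layers\<close>

text \<open>
  Here \<open>A k\<close> and \<open>S k\<close> are the traces on the \<open>k\<close>-th layer of a union of components and of the
  deleted set. The lowest and the highest layer met by \<open>A\<close> already force \<open>2 * min_degree G\<close>
  deleted vertices just outside of them, so the layers between them are untouched.
\<close>

lemma layers_isolated:
  fixes A S :: "nat \<Rightarrow> 'a set"
  assumes G: "pair_graph G"
    and conn: "0 < connectivity (direct_product G (complete_graph 2))"
    and S: "\<And>k. S k \<subseteq> pverts G" and A: "\<And>k. A k \<subseteq> pverts G - S k"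
    and up: "\<And>k x. x \<in> A k \<Longrightarrow> neighborhood G x \<subseteq> A (Suc k) \<union> S (Suc k)"
    and down: "\<And>k x. x \<in> A (Suc k) \<Longrightarrow> neighborhood G x \<subseteq> A k \<union> S k"
    and first: "A 0 = {}" "card (S 0) < min_degree G"
    and last: "A N = {}" "card (S N) < min_degree G"
    and ne: "k0 \<le> N" "A k0 \<noteq> {}"
    and small: "(\<Sum>k\<le>N. card (S k)) \<le> 2 * min_degree G"
  shows "\<exists>k x. x \<in> A (Suc k) \<and> neighborhood G x \<subseteq> S k \<and> neighborhood G x \<subseteq> S (Suc (Suc k))"
proof -
  let ?d = "min_degree G"
  have finS: "finite (S k)" for k
    using S G finite_subset by (metis pair_graph_iff)
  have degree: "?d \<le> card T" if "x \<in> A k" "neighborhood G x \<subseteq> T" "finite T" for x k T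
    using min_degree_le_card_neighborhood[OF G, of x] card_mono[OF that(3,2)] that(1) A by force
  define c where "c = (LEAST k. A k \<noteq> {})"
  have Ac: "A c \<noteq> {}"
    unfolding c_def using ne(2) by (rule LeastI)
  have below: "A k = {}" if "k < c" for k
    using not_less_Least[of k "\<lambda>k. A k \<noteq> {}"] that unfolding c_def by blast
  have "c \<noteq> 0"
    using Ac first by metis
  then obtain b where b: "c = Suc b"
    using not0_implies_Suc by blast
  \<comment> \<open>The bound \<open>N\<close> is needed for the maximum to exist: the layers used
    later repeat periodically.\<close>
  define d where "d = Max {k. k \<le> N \<and> A k \<noteq> {}}"
  have fin: "finite {k. k \<le> N \<and> A k \<noteq> {}}"
    by simp
  have "d \<in> {k. k \<le> N \<and> A k \<noteq> {}}"
    unfolding d_def using ne by (intro Max_in[OF fin]) blast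
  then have d: "d < N" "A d \<noteq> {}"
    using last by (auto simp: le_less)
  have le_d: "k \<le> d" if "k \<le> N" "A k \<noteq> {}" for k
    unfolding d_def using that by (intro Max_ge[OF fin]) simp
  then have above: "A (Suc d) = {}"
    using le_d[of "Suc d"] d(1) by fastforce
  have cd: "c \<le> d"
    unfolding c_def using d by (intro Least_le)
  have Nb: "neighborhood G x \<subseteq> S b" if "x \<in> A c" for x
    using down[of x b] that below[of b] by (simp add: b)
  have Nd: "neighborhood G x \<subseteq> S (Suc d)" if "x \<in> A d" for x
    using up[of x d] that above by simp
  have Sb: "?d \<le> card (S b)"
    using degree Nb finS Ac by blast
  have Sd: "?d \<le> card (S (Suc d))"
    using degree Nd finS d by blast
  show ?thesis
  proof (cases "c = d")
    case True
    then show ?thesis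
      using Nb Nd Ac b by blast
  next
    case False
    have sub: "(\<Sum>k\<in>K. card (S k)) \<le> 2 * ?d" if "K \<subseteq> {..N}" for K
      using sum_mono2[OF _ that, of "\<lambda>k. card (S k)"] small by simp
    have "card (S b) + card (S (Suc d)) \<le> 2 * ?d"
      using sub[of "{b, Suc d}"] cd d b by simp
    have clean: "S k = {}" if "k \<le> N" "k \<noteq> b" "k \<noteq> Suc d" for k
    proof -
      have "card (S k) + (card (S b) + card (S (Suc d))) \<le> 2 * ?d"
        using sub[of "{k, b, Suc d}"] that cd d b by simp
      then have "card (S k) = 0"
        using Sb Sd by linarith
      then show ?thesis
        using finS by simp
    qed
    \<comment> \<open>Since \<open>c < d\<close>, nothing is deleted from layers \<open>c\<close>
      and \<open>Suc c\<close>, so positive connectivity alone makes layer \<open>c\<close>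
      full.\<close>
    have "A c = {} \<and> A (Suc c) = {} \<or> A c = pverts G - {} \<and> A (Suc c) = pverts G - {}"
    proof (rule direct_product_K2_closed[OF G])
      have "S c = {}" "S (Suc c) = {}"
        using False cd d b by (intro clean; simp)+
      then show "\<And>x. x \<in> A c \<Longrightarrow> neighborhood G x \<subseteq> A (Suc c) \<union> {}"
        "\<And>y. y \<in> A (Suc c) \<Longrightarrow> neighborhood G y \<subseteq> A c \<union> {}"
        using up[of _ c] down[of _ c] by auto
    qed (use A conn in auto)
    then have all: "A c = pverts G"
      using Ac by simp
    \<comment> \<open>Each \<open>y\<close> has a neighbour \<open>x\<close> in the full layer
      \<open>c\<close>, and \<open>Nb\<close> puts the neighbours of \<open>x\<close>, hence
      \<open>y\<close>, into \<open>S b\<close>. This makes \<open>S b\<close> larger than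
      \<open>?d\<close>, and with \<open>Sd\<close> the budget is exceeded.\<close>
    have "pverts G \<subseteq> S b"
    proof
      fix y assume y: "y \<in> pverts G"
      have "0 < card (neighborhood G y)"
        using min_degree_le_card_neighborhood[OF G y] first by simp
      then obtain x where "x \<in> neighborhood G y"
        by fastforce
      then have "x \<in> A c" "y \<in> neighborhood G x"
        using all G by (auto simp: neighborhood_def pair_graph_iff dest: symD)
      then show "y \<in> S b"
        using Nb by blast
    qed
    then have "card (pverts G) \<le> card (S b)"
      using finS by (simp add: card_mono)
    moreover have "?d < card (pverts G)"
      using Ac A by (intro min_degree_less_card[OF G]) blast
    ultimately show ?thesis
      using \<open>card (S b) + card (S (Suc d)) \<le> 2 * ?d\<close> Sd by simp
  qed
qed

section \<open>Cycles and sums over their layers\<close>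

lemma Suc_mod_eqD:
  fixes j k n :: nat
  assumes "Suc j mod n = Suc k mod n"
  shows "j mod n = k mod n"
  using assms by (simp add: mod_Suc split: if_splits)

text \<open>Centring at \<open>Suc k\<close> avoids subtraction when naming the predecessor.\<close>

lemma neighborhood_cycle_graph_Suc:
  assumes "n > 0"
  shows "neighborhood (cycle_graph n) (Suc k mod n) = {k mod n, Suc (Suc k) mod n}"
proof -
  have "j = k mod n" if "j < n" "Suc k mod n = Suc j mod n" for j
    using Suc_mod_eqD[OF that(2)] that(1) by simp
  then show ?thesis
    using assms by (auto simp: neighborhood_def cycle_graph_def mod_Suc_eq)
qed

lemma card_neighborhood_cycle_graph:
  assumes "n \<ge> 3" and "i < n"
  shows "card (neighborhood (cycle_graph n) i) = 2"
proof -
  \<comment> \<open>Modulo \<open>n\<close>, adding \<open>n - 1\<close> is a step back by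
    one.\<close>
  define k where "k = i + (n - 1)"
  have "i = Suc k mod n"
    using assms by (simp add: k_def)
  then have "neighborhood (cycle_graph n) i = {k mod n, Suc (Suc k) mod n}"
    using neighborhood_cycle_graph_Suc[of n k] assms by simp
  moreover have "k mod n \<noteq> Suc (Suc k) mod n"
    using assms by (auto simp: mod_Suc)
  ultimately show ?thesis
    by simp
qed

text \<open>Lets the cycle be cut open at any layer: moving the window by one drops
  \<open>f m\<close> and gains the equal \<open>f (m + n)\<close>.\<close>

lemma sum_shift_periodic:
  fixes f :: "nat \<Rightarrow> nat"
  assumes "\<And>k. f (k + n) = f k"
  shows "(\<Sum>k<n. f (m + k)) = (\<Sum>k<n. f k)"
proof (induction m)
  case (Suc m)
  have "f m + (\<Sum>k<n. f (Suc m + k)) = (\<Sum>k<Suc n. f (m + k))"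
    by (subst sum.lessThan_Suc_shift) simp
  also have "\<dots> = (\<Sum>k<n. f (m + k)) + f m"
    using assms[of m] by simp
  finally show ?case
    using Suc by simp
qed simp

lemma card_eq_sum_layers:
  assumes "finite S" and "snd ` S \<subseteq> {..<n::nat}"
  shows "card S = (\<Sum>k<n. card {x. (x, k) \<in> S})"
proof -
  have "S = (\<Union>k<n. (\<lambda>x. (x, k)) ` {x. (x, k) \<in> S})"
    using assms(2) by (auto simp: image_subset_iff)
  moreover have "finite {x. (x, k) \<in> S}" for k
    using assms(1) by (rule finite_surj[of _ _ fst]) force
  ultimately have "card S = (\<Sum>k<n. card ((\<lambda>x. (x, k)) ` {x. (x, k) \<in> S}))"
    by (subst (1) \<open>S = _\<close>, subst card_UN_disjoint) auto
  then show ?thesis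
    by (simp add: card_image inj_on_def)
qed

section \<open>Minimum cuts of the product with an odd cycle\<close>

theorem theorem3p8:
  fixes G :: "'a pair_pre_digraph" and n :: nat
  assumes "pair_graph G"
    and "Digraph_Component.connected (with_proj G)"
    and "\<not> bipartite G"
    and "n \<ge> 7" and "odd n"
    and "real (connectivity (direct_product G (complete_graph 2)))
           > 4 / (real n - 1) * real (min_degree G)"
  shows "super_connected (direct_product G (cycle_graph n))"
  unfolding super_connected_def
proof (intro allI impI)
  let ?P = "direct_product G (cycle_graph n)"
  let ?\<kappa> = "connectivity (direct_product G (complete_graph 2))"
  let ?\<delta> = "min_degree G"
  fix S assume min: "minimum_vertex_cut ?P S"
  note G = assms(1)
  have n: "n > 0" "n \<ge> 3"
    using assms(4) by auto
  have P: "pair_graph ?P"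
    using G pair_graph_cycle_graph n by (intro pair_graph_direct_product) auto
  have ne: "pverts G \<noteq> {}"
    using assms(2) by (auto simp: connected_def strongly_connected_def)
  have vP: "pverts ?P = pverts G \<times> {..<n}"
    by (simp add: pverts_direct_product cycle_graph_def)
  have cardN: "card (neighborhood ?P (x, i)) = 2 * card (neighborhood G x)" if "i < n" for x i
    using that n
    by (simp add: neighborhood_direct_product card_cartesian_product card_neighborhood_cycle_graph)
  have cut: "vertex_cut ?P S"
    using min by (simp add: minimum_vertex_cut_def)
  have le: "card S \<le> card (neighborhood ?P v)" if v: "v \<in> pverts ?P" for v
  proof -
    obtain x i where [simp]: "v = (x, i)"
      by fastforce
    \<comment> \<open>The surviving vertex is a copy of \<open>x\<close> in another layer, not
      adjacent to \<open>v\<close> because \<open>G\<close> has no loops.\<close>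
    have "vertex_cut ?P (neighborhood ?P v)"
      using v n
      by (intro vertex_cut_neighborhood[OF P, where w = "(x, if i = 0 then 1 else 0)"])
         (auto simp: vP not_adjacent_same_fst[OF G])
    then show ?thesis
      using min by (simp add: minimum_vertex_cut_def)
  qed
  obtain x0 where "x0 \<in> pverts G" "card (neighborhood G x0) = ?\<delta>"
    using min_degree_attained[OF G ne] by blast
  then have small: "card S \<le> 2 * ?\<delta>"
    using le[of "(x0, 0)"] cardN[of 0 x0] n by (simp add: vP)
  \<comment> \<open>Weakens \<open>n - 1\<close> to \<open>n\<close>, the number of pairs of
    consecutive layers in the averaging.\<close>
  have "4 * real ?\<delta> < real ?\<kappa> * (real n - 1)"
    using assms(6) n by (simp add: field_simps)
  then have "4 * real ?\<delta> < real n * real ?\<kappa>"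
    by (simp add: algebra_simps)
  then have \<kappa>: "4 * ?\<delta> < n * ?\<kappa>"
    by (metis of_nat_less_iff of_nat_mult of_nat_numeral)
  then have "?\<kappa> > 0"
    by (cases "?\<kappa> = 0") auto
  have \<kappa>\<delta>: "?\<kappa> \<le> ?\<delta>"
    by (rule connectivity_direct_product_K2_le[OF G ne])

  obtain A where SP: "S \<subseteq> pverts ?P" and A: "A \<noteq> {}" "A \<subset> pverts ?P - S"
    and closed: "\<forall>u\<in>A. neighborhood ?P u \<subseteq> A \<union> S"
    using cut unfolding vertex_cut_iff[OF P] by blast
  have finS: "finite S"
    using SP P finite_subset by (metis pair_graph_iff)
  \<comment> \<open>Reducing \<open>k\<close> modulo \<open>n\<close> unrolls the cycle, so that
    layers can be indexed by all naturals.\<close>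
  define layer where "layer C k = {x. (x, k mod n) \<in> C}" for C :: "('a \<times> nat) set" and k
  have layer_mod: "layer C (k + n) = layer C k" for C k
    by (simp add: layer_def)
  have layerV: "layer C k \<subseteq> pverts G - layer S k" if "C \<subseteq> pverts ?P - S" for C k
    using that by (auto simp: layer_def vP)
  have layerS: "layer S k \<subseteq> pverts G" for k
    using SP by (auto simp: layer_def vP)
  have up: "neighborhood G x \<subseteq> layer C (Suc k) \<union> layer S (Suc k)"
    if "\<forall>u\<in>C. neighborhood ?P u \<subseteq> C \<union> S" "x \<in> layer C k" for C k x
  proof -
    have "k mod n \<in> neighborhood (cycle_graph n) (Suc k mod n)"
      using neighborhood_cycle_graph_Suc[OF n(1)] by simp
    then have "Suc k mod n \<in> neighborhood (cycle_graph n) (k mod n)"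
      using pair_graph_cycle_graph[of n] n by (auto simp: neighborhood_def pair_graph_iff dest: symD)
    then show ?thesis
      using that by (fastforce simp: layer_def neighborhood_direct_product)
  qed
  have down: "neighborhood G x \<subseteq> layer C k \<union> layer S k"
    if "\<forall>u\<in>C. neighborhood ?P u \<subseteq> C \<union> S" "x \<in> layer C (Suc k)" for C k x
  proof -
    have "k mod n \<in> neighborhood (cycle_graph n) (Suc k mod n)"
      using neighborhood_cycle_graph_Suc[OF n(1)] by simp
    then show ?thesis
      using that by (fastforce simp: layer_def neighborhood_direct_product)
  qed
  have sumS: "(\<Sum>k<n. card (layer S (m + k))) = card S" for m
  proof -
    have "(\<Sum>k<n. card (layer S (m + k))) = (\<Sum>k<n. card (layer S k))"
      by (rule sum_shift_periodic) (simp add: layer_mod)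
    also have "\<dots> = card S"
      using SP by (subst card_eq_sum_layers[OF finS]) (auto simp: layer_def vP)
    finally show ?thesis .
  qed

  \<comment> \<open>Each layer lies in two of the \<open>n\<close> pairs, so the pairs total
    \<open>2 * card S\<close>, at most \<open>4 * ?\<delta>\<close> and thus below
    \<open>n * ?\<kappa>\<close>.\<close>
  have "\<exists>e<n. card (layer S e) + card (layer S (Suc e)) < ?\<kappa>"
  proof (rule ccontr)
    assume "\<not> ?thesis"
    then have "(\<Sum>e<n. ?\<kappa>) \<le> (\<Sum>e<n. card (layer S e) + card (layer S (Suc e)))"
      by (intro sum_mono) (meson lessThan_iff not_less)
    also have "\<dots> = 2 * card S"
      using sumS[of 0] sumS[of 1] by (simp add: sum.distrib)
    finally show False
      using small \<kappa> by simp
  qed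
  then obtain e where e: "e < n" "card (layer S e) + card (layer S (Suc e)) < ?\<kappa>"
    by blast

  \<comment> \<open>\<open>A\<close> either misses both layers or contains all that is left of them.
    In the second case its complement outside \<open>S\<close> is taken, which is closed by symmetry
    of adjacency.\<close>
  obtain C where C: "C \<noteq> {}" "C \<subseteq> pverts ?P - S" "\<forall>u\<in>C. neighborhood ?P u \<subseteq> C \<union> S"
    and Ce: "layer C e = {}" "layer C (Suc e) = {}"
  proof -
    have "layer A e = {} \<and> layer A (Suc e) = {} \<or>
      layer A e = pverts G - layer S e \<and> layer A (Suc e) = pverts G - layer S (Suc e)"
      using e(2) layerS layerV[of A] A(2) up[OF closed] down[OF closed]
      by (intro direct_product_K2_closed[OF G]) blast+
    then show thesis
    proof
      assume "layer A e = {} \<and> layer A (Suc e) = {}"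
      then show thesis
        using that A closed by blast
    next
      assume full: "layer A e = pverts G - layer S e \<and>
        layer A (Suc e) = pverts G - layer S (Suc e)"
      let ?C = "pverts ?P - S - A"
      have "neighborhood ?P u \<subseteq> ?C \<union> S" if "u \<in> ?C" for u
      proof
        fix w assume w: "w \<in> neighborhood ?P u"
        then have "u \<in> neighborhood ?P w"
          using P by (auto simp: neighborhood_def pair_graph_iff dest: symD)
        then have "w \<notin> A"
          using closed that by blast
        then show "w \<in> ?C \<union> S"
          using w neighborhood_subset[OF P] by blast
      qed
      moreover have "layer ?C e = {}" "layer ?C (Suc e) = {}"
        using full by (auto simp: layer_def vP)
      ultimately show thesis
        using that[of ?C] A by blast
    qed
  qed

  obtain k0 where k0: "k0 \<le> n - 1" "layer C (Suc e + k0) \<noteq> {}"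
  proof -
    obtain x i where xi: "(x, i) \<in> C"
      using C(1) by fastforce
    then have "i < n"
      using C(2) by (auto simp: vP)
    \<comment> \<open>The offset of \<open>i\<close> from \<open>Suc e\<close>; adding
      \<open>n\<close> first keeps the subtraction from truncating.\<close>
    let ?k = "(i + n - Suc e) mod n"
    have "(Suc e + ?k) mod n = i"
      using \<open>i < n\<close> e(1) by (subst mod_add_right_eq) simp
    then have "layer C (Suc e + ?k) \<noteq> {}"
      using xi by (auto simp: layer_def)
    moreover have "?k < n"
      using n by simp
    ultimately show thesis
      using that[of ?k] by simp
  qed

  have "\<exists>k x. x \<in> layer C (Suc e + Suc k) \<and> neighborhood G x \<subseteq> layer S (Suc e + k) \<and>
    neighborhood G x \<subseteq> layer S (Suc e + Suc (Suc k))"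
  \<comment> \<open>Counting starts at layer \<open>Suc e\<close>, so index \<open>n - 1\<close> is
    layer \<open>e\<close> again: both ends avoid \<open>C\<close>, and
    \<open>\<kappa>\<delta>\<close> bounds what \<open>S\<close> has there.\<close>
  proof (rule layers_isolated[OF G \<open>?\<kappa> > 0\<close>, where N = "n - 1"])
    have "Suc e + (n - 1) = e + n"
      using n by simp
    then show "layer C (Suc e + (n - 1)) = {}" "card (layer S (Suc e + (n - 1))) < ?\<delta>"
      using Ce e(2) \<kappa>\<delta> by (simp_all add: layer_mod)
    show "layer C (Suc e + 0) = {}" "card (layer S (Suc e + 0)) < ?\<delta>"
      using Ce e(2) \<kappa>\<delta> by simp_all
    have "{..n - 1} = {..<n}"
      using n by auto
    then show "(\<Sum>k\<le>n - 1. card (layer S (Suc e + k))) \<le> 2 * ?\<delta>"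
      using sumS small by metis
  qed (use k0 layerS layerV[OF C(2)] up[OF C(3)] down[OF C(3)] in auto)
  then obtain k x where x: "x \<in> layer C (Suc (Suc e + k))"
    "neighborhood G x \<subseteq> layer S (Suc e + k)"
    "neighborhood G x \<subseteq> layer S (Suc (Suc (Suc e + k)))"
    by auto
  let ?v = "(x, Suc (Suc e + k) mod n)"
  have v: "?v \<in> pverts ?P"
    using x(1) C(2) by (auto simp: layer_def)
  have "neighborhood ?P ?v \<subseteq> S"
    using x(2,3) unfolding neighborhood_direct_product neighborhood_cycle_graph_Suc[OF n(1)]
    by (auto simp: layer_def)
  \<comment> \<open>A minimum cut is no larger than any neighbourhood, so the inclusion is an
    equality.\<close>
  then have S: "S = neighborhood ?P ?v"
    using le[OF v] finS by (metis card_seteq)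
  \<comment> \<open>By \<open>le\<close>, every neighbourhood has at least \<open>card S\<close>
    elements, and that of \<open>?v\<close> attains this.\<close>
  moreover have "min_degree ?P = card (neighborhood ?P ?v)"
    using P v le S unfolding min_degree_def out_degree_eq_card_neighborhood
    by (intro Min_eqI) (auto simp: pair_graph_iff)
  ultimately show "\<exists>v\<in>pverts ?P. out_degree (with_proj ?P) v = min_degree ?P \<and>
    S = neighborhood ?P v"
    using v by (metis out_degree_eq_card_neighborhood)
qed

end
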